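(* Let $a=2^s$ with $s\ge1$ an integer, let $q=2^a+1$ be a Fermat prime and $p$ a prime divisor of $2^a-1$. Let $S=-S\subseteq\mathbb{Z}_p^*$ and $U\subseteq\mathbb{Z}_p$. If $S=\emptyset$ then $\omega(\Gamma(a,p,S,U))\le\frac{2^a}{p-1}|U|+1$, and if $S\ne\emptyset$ then $\omega(\Gamma(a,p,S,U))\le\frac{2^a}{p-1}|U|+p-1$.
   Context: A Fermat prime is a prime of the form $2^{2^s}+1$ with $s\ge0$ an integer. $\omega$ denotes the clique number. The Marušič-Scapellato graph $\Gamma(a,p,S,U)$ is defined as follows. Let $w$ be a primitive element of $\mathrm{GF}(2^a)$. The vertex set is $(\mathrm{GF}(2^a)\cup\{\infty\})\times\mathbb{Z}_p$. The neighbourhood of $(\infty,r)$ is $\{(\infty,r+s'):s'\in S\}\cup\{(x,r+u):x\in\mathrm{GF}(2^a),u\in U\}$. The neighbourhood of $(x,r)$ with $x\in\mathrm{GF}(2^a)$ is $\{(x,r+s'):s'\in S\}\cup\{(\infty,r-u):u\in U\}\cup\{(x+w^i,-r+u+2i):i\in\mathbb{Z}_{2^a-1},u\in U\}$. $S$ may be empty.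
   Formalization: For S nonempty the bound is proved only when U is not all of Z_p and not both U is empty and S = Z_p^*; in the excluded cases the stated bound is false (e.g. a=2, p=3, S=Z_3^*, U=Z_3 gives K_15 against a bound of 8). *)

theory Defs
  imports
    "Berlekamp_Zassenhaus.Finite_Field"
    "Graph_Theory.Pair_Digraph"
begin

definition fermat_prime :: "nat \<Rightarrow> bool" where
  "fermat_prime n \<longleftrightarrow> prime n \<and> (\<exists>s::nat. n = 2 ^ 2 ^ s + 1)"

definition primitive_element :: "'f :: field \<Rightarrow> bool" where
  "primitive_element w \<longleftrightarrow> range (\<lambda>i::nat. w ^ i) = UNIV - {0}"

definition clique :: "('v, 'e) pre_digraph \<Rightarrow> 'v set \<Rightarrow> bool" where
  "clique G K \<longleftrightarrow> K \<subseteq> verts G \<and> (\<forall>x\<in>K. \<forall>y\<in>K. x \<noteq> y \<longrightarrow> x \<rightarrow>\<^bsub>G\<^esub> y)"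

(* Meant for graphs with finitely many vertices: Max is unspecified on infinite sets. *)
definition clique_number :: "('v, 'e) pre_digraph \<Rightarrow> nat" where
  "clique_number G = Max (card ` {K. clique G K})"

(* In the two definitions below 'f is GF(2^a), 'p mod_ring is the ring of integers modulo the
   prime p = CARD('p), and None is the point at infinity.
   The exponent i runs through the residues modulo 2^a - 1, represented by 0, ..., 2^a - 2;
   its image in 'p mod_ring does not depend on the representative because p divides 2^a - 1. *)

definition MS_nbhd ::
  "'f :: {field, finite} \<Rightarrow> 'p :: prime_card mod_ring set \<Rightarrow> 'p mod_ring set \<Rightarrow>
     'f option \<times> 'p mod_ring \<Rightarrow> ('f option \<times> 'p mod_ring) set"
where
  "MS_nbhd w S U v = (case v of
     (None, r) \<Rightarrow>
       {(None, r + s) | s. s \<in> S} \<union>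
       {(Some x, r + u) | x u. u \<in> U}
   | (Some x, r) \<Rightarrow>
       {(Some x, r + s) | s. s \<in> S} \<union>
       {(None, r - u) | u. u \<in> U} \<union>
       {(Some (x + w ^ i), - r + u + 2 * of_nat i) | i u. i < CARD('f) - 1 \<and> u \<in> U})"

definition MS_graph ::
  "'f :: {field, finite} \<Rightarrow> 'p :: prime_card mod_ring set \<Rightarrow> 'p mod_ring set \<Rightarrow>
     ('f option \<times> 'p mod_ring) pair_pre_digraph"
where
  "MS_graph w S U = \<lparr> pverts = UNIV, parcs = {(v, v'). v' \<in> MS_nbhd w S U v} \<rparr>"

lemma char_2_if_card_power_2:
  fixes x :: "'f :: {field, finite}"
  assumes "CARD('f) = 2 ^ a" "a \<ge> 1"
  shows "x + x = 0"
proof -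
  have "(\<Sum>y::'f\<in>UNIV. y + 1) = (\<Sum>y\<in>UNIV. y)"
    by (rule sum.reindex_bij_witness[where i = "\<lambda>y. y - 1" and j = "\<lambda>y. y + 1"]) auto
  then have "of_nat CARD('f) = (0 :: 'f)"
    by (simp add: sum.distrib)
  then have "(2 :: 'f) = 0"
    by (simp add: assms(1))
  then show ?thesis
    by (metis mult_2 mult_zero_left)
qed

lemma MS_nbhd_simps:
  fixes w :: "'f :: {field, finite}"
  shows "MS_nbhd w S U (None, r) = {(None, r + s) | s. s \<in> S} \<union> {(Some x, r + u) | x u. u \<in> U}"
    and "MS_nbhd w S U (Some x, r) =
      {(Some x, r + s) | s. s \<in> S} \<union>
      {(None, r - u) | u. u \<in> U} \<union>
      {(Some (x + w ^ i), - r + u + 2 * of_nat i) | i u. i < CARD('f) - 1 \<and> u \<in> U}"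
  by (simp_all add: MS_nbhd_def)

lemma pair_graph_MS_graph:
  fixes w :: "'f :: {field, finite}" and S U :: "'p :: prime_card mod_ring set"
  assumes "CARD('f) = 2 ^ a" "a \<ge> 1" "w \<noteq> 0" "0 \<notin> S" "uminus ` S = S"
  shows "pair_graph (MS_graph w S U)"
proof -
  have dbl: "x + w ^ i + w ^ i = x" for x :: 'f and i
    using char_2_if_card_power_2[OF assms(1,2), of "w ^ i"] by (simp add: add.assoc)
  have neg: "- s \<in> S" if "s \<in> S" for s
    using that assms(5) by blast
  have irr: "v \<notin> MS_nbhd w S U v" for v
    using assms(3,4) by (auto simp: MS_nbhd_def split: prod.splits option.splits)
  have sym: "v \<in> MS_nbhd w S U v'" if v': "v' \<in> MS_nbhd w S U v" for v v'
  proof (cases v)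
    case (Pair x r)
    show ?thesis
    proof (cases x)
      case None
      from v' consider s where "s \<in> S" "v' = (None, r + s)"
        | y u where "u \<in> U" "v' = (Some y, r + u)"
        unfolding Pair None by (auto simp: MS_nbhd_def)
      then show ?thesis
      proof cases
        case 1
        then have "r = r + s + - s" "- s \<in> S" using neg by auto
        then show ?thesis unfolding Pair None 1(2) MS_nbhd_simps by blast
      next
        case 2
        then have "r = r + u - u" by simp
        then show ?thesis using 2(1) unfolding Pair None 2(2) MS_nbhd_simps by blast
      qed
    next
      case (Some y)
      from v' consider s where "s \<in> S" "v' = (Some y, r + s)"
        | u where "u \<in> U" "v' = (None, r - u)"
        | i u where "u \<in> U" "i < CARD('f) - 1" "v' = (Some (y + w ^ i), - r + u + 2 * of_nat i)"
        unfolding Pair Some by (auto simp: MS_nbhd_def)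
      then show ?thesis
      proof cases
        case 1
        then have "r = r + s + - s" "- s \<in> S" using neg by auto
        then show ?thesis unfolding Pair Some 1(2) MS_nbhd_simps by blast
      next
        case 2
        then have "r = r - u + u" by simp
        then show ?thesis using 2(1) unfolding Pair Some 2(2) MS_nbhd_simps by blast
      next
        case 3
        have "(Some y, r) =
            (Some (y + w ^ i + w ^ i), - (- r + u + 2 * of_nat i) + u + 2 * of_nat i)"
          by (simp add: dbl)
        then show ?thesis using 3(1,2) unfolding Pair Some 3(3) MS_nbhd_simps by blast
      qed
    qed
  qed
  have "sym (parcs (MS_graph w S U))"
    by (rule symI) (simp add: MS_graph_def sym)
  then have "symmetric (MS_graph w S U)"
    by (simp add: symmetric_def arcs_ends_def arc_to_ends_def with_proj_def)
  then show ?thesis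
    by unfold_locales (auto simp: MS_graph_def irr)
qed

end

theory Submission
  imports Defs
begin

(* Fix a vertex v of a clique K. The vertices of K outside the block of v are labelled by elements
   of U. In suitable affine coordinates with v's block at infinity, the vertices with a given label
   form a set X in GF(2^a) all of whose differences have logarithm modulo p in a proper subset D of
   Z_p. Since p divides 2^b + 1 for some b with 2b | a, all nonzero elements of the subfield GF(2^b)
   have logarithm 0 modulo p, so the differences of w^e GF(2^b) have logarithm e, which is taken
   outside D. Hence addition is injective on X \<times> w^e GF(2^b), and |X| is at most
   2^a / 2^b \<le> 2^a / (p - 1). *)

section \<open>Fermat numbers dividing \<open>2 ^ 2 ^ s - 1\<close>\<close>

text \<open>Iterating x^2 - 1 = (x - 1)(x + 1) turns \<open>2 ^ 2 ^ s - 1\<close> into the product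
  of the Fermat numbers with index below s, and the prime p divides one of them. The factors before
  that one multiply to \<open>2 ^ 2 ^ j - 1\<close>, those after it to \<open>m\<close>.\<close>

lemma fermat_factor:
  fixes p :: nat
  assumes "prime p" "p dvd 2 ^ 2 ^ s - 1"
  obtains j m where "2 ^ 2 ^ s - 1 = (2 ^ 2 ^ j - 1) * (2 ^ 2 ^ j + 1) * (m :: nat)"
    "p dvd 2 ^ 2 ^ j + 1"
proof -
  have "\<exists>j m. 2 ^ 2 ^ s - 1 = (2 ^ 2 ^ j - 1) * (2 ^ 2 ^ j + 1) * (m :: nat) \<and> p dvd 2 ^ 2 ^ j + 1"
    using assms(2)
  proof (induction s)
    case 0
    then show ?case using assms(1) by auto
  next
    case (Suc s)
    have split: "(2 :: nat) ^ 2 ^ Suc s - 1 = (2 ^ 2 ^ s - 1) * (2 ^ 2 ^ s + 1)"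
      by (simp add: power_mult diff_mult_distrib power2_eq_square mult.commute[of 2])
    show ?case
    proof (cases "p dvd 2 ^ 2 ^ s - 1")
      case True
      then obtain j m where "2 ^ 2 ^ s - 1 = (2 ^ 2 ^ j - 1) * (2 ^ 2 ^ j + 1) * (m :: nat)"
        "p dvd 2 ^ 2 ^ j + 1" using Suc.IH by blast
      then show ?thesis unfolding split by (metis mult.assoc)
    next
      case False
      then have "p dvd 2 ^ 2 ^ s + 1"
        using Suc.prems unfolding split prime_dvd_mult_iff[OF assms(1)] by blast
      then show ?thesis unfolding split by (intro exI[of _ s] exI[of _ 1]) simp
    qed
  qed
  then show thesis using that by blast
qed

section \<open>Logarithms to base w modulo p\<close>

text \<open>For primitive w the exponent is determined only modulo |GF(2^a)| - 1; this is a multiple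
  of p, so its residue modulo p does not depend on the choice. The value at 0 is
  unspecified.\<close>

definition dlog :: "'f :: field \<Rightarrow> 'f \<Rightarrow> 'p :: prime_card mod_ring" where
  "dlog w y = of_nat (SOME i. w ^ i = y)"

locale marusic_scapellato =
  fixes w :: "'f :: {field, finite}" and S U :: "'p :: prime_card mod_ring set" and s :: nat
  assumes card_f: "CARD('f) = 2 ^ 2 ^ s"
    and primitive: "primitive_element w"
    and dvd: "CARD('p) dvd 2 ^ 2 ^ s - 1"
    and S_nonzero: "0 \<notin> S"
begin

lemma exp_pos: "(0 :: nat) < 2 ^ 2 ^ s - 1"
  using one_less_power[of "2 :: nat" "2 ^ s"] by (simp add: zero_less_diff)

lemma w_nonzero: "w \<noteq> 0"
proof
  assume "w = 0"
  then have "w ^ 1 = 0" by simp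
  then show False using primitive unfolding primitive_element_def by blast
qed

lemma power_surj: assumes "y \<noteq> 0" obtains i :: nat where "y = w ^ i"
  using primitive assms unfolding primitive_element_def by blast

lemma power_diff_eq_1: "w ^ i = w ^ j \<Longrightarrow> i \<le> j \<Longrightarrow> w ^ (j - i) = 1"
  using w_nonzero by (simp add: power_diff)

lemma power_mod: "w ^ n = 1 \<Longrightarrow> w ^ (i mod n) = w ^ i"
  by (metis mod_mult_div_eq mult_1_right power_add power_mult power_one)

text \<open>If \<open>w ^ n = 1\<close>, then the powers with exponent below n already exhaust the
  nonzero elements.\<close>

lemma period_ge:
  assumes "w ^ n = 1" "n > 0"
  shows "2 ^ 2 ^ s - 1 \<le> n"
proof -
  have "UNIV - {0} \<subseteq> (\<lambda>i. w ^ i) ` {..<n}"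
    using power_surj power_mod[OF assms(1)] assms(2)
    by (metis Diff_iff image_eqI lessThan_iff mod_less_divisor singletonI subsetI)
  then have "card (UNIV - {0 :: 'f}) \<le> card {..<n}"
    using surj_card_le[of "{..<n}"] by blast
  then show ?thesis by (simp add: card_f)
qed

lemma power_period: "w ^ (2 ^ 2 ^ s - 1) = 1"
proof -
  let ?N = "2 ^ 2 ^ s - 1 :: nat"
  \<comment> \<open>Pigeonhole: \<open>?N + 1\<close> exponents share \<open>?N\<close> nonzero
    values. A coincidence gives a period of at most \<open>?N\<close>, which
    \<open>period_ge\<close> forces to be \<open>?N\<close>.\<close>
  have "(\<lambda>i. w ^ i) ` {..?N} \<subseteq> UNIV - {0}" using w_nonzero by auto
  then have "card ((\<lambda>i. w ^ i) ` {..?N}) \<le> card (UNIV - {0 :: 'f})" by (intro card_mono) auto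
  then have "\<not> inj_on (\<lambda>i. w ^ i) {..?N}"
    using exp_pos by (auto dest!: card_image simp: card_f simp del: zero_less_diff)
  then obtain i j where ij: "i < j" "j \<le> ?N" "w ^ i = w ^ j"
    unfolding inj_on_def by (metis atMost_iff linorder_neqE_nat)
  then have "w ^ (j - i) = 1" by (intro power_diff_eq_1) auto
  moreover from this have "?N \<le> j - i" using ij by (intro period_ge) auto
  ultimately show ?thesis using ij by (metis diff_le_self le_antisym le_trans)
qed

lemma power_eq_1_iff: "w ^ n = 1 \<longleftrightarrow> 2 ^ 2 ^ s - 1 dvd n"
proof
  let ?N = "2 ^ 2 ^ s - 1 :: nat"
  assume "w ^ n = 1"
  then have "w ^ (n mod ?N) = 1" using power_mod[OF power_period] by simp
  moreover have "n mod ?N < ?N" using exp_pos by (rule mod_less_divisor)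
  ultimately have "n mod ?N = 0" using period_ge[of "n mod ?N"] by linarith
  then show "?N dvd n" by blast
next
  assume "2 ^ 2 ^ s - 1 dvd n"
  then obtain k where "n = (2 ^ 2 ^ s - 1) * k" by (rule dvdE)
  then show "w ^ n = 1" by (simp only: power_mult power_period power_one)
qed

lemma of_nat_cong:
  assumes "w ^ i = w ^ j"
  shows "of_nat i = (of_nat j :: 'p mod_ring)"
proof -
  have "of_nat i = (of_nat j :: 'p mod_ring)" if "i \<le> j" "w ^ i = w ^ j" for i j
  proof -
    from that have "w ^ (j - i) = 1" by (intro power_diff_eq_1)
    then have "CARD('p) dvd j - i" using power_eq_1_iff dvd dvd_trans by blast
    then have "of_nat (j - i) = (0 :: 'p mod_ring)" by (auto simp: dvd_def)
    then show ?thesis using that by (simp add: of_nat_diff)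
  qed
  then show ?thesis using assms by (metis nle_le)
qed

abbreviation lg :: "'f \<Rightarrow> 'p mod_ring" where "lg \<equiv> dlog w"

lemma lg_power: "lg (w ^ i) = of_nat i"
  unfolding dlog_def by (rule of_nat_cong) (rule someI, rule refl)

lemma lg_mult: "x \<noteq> 0 \<Longrightarrow> y \<noteq> 0 \<Longrightarrow> lg (x * y) = lg x + lg y"
  by (elim power_surj) (simp add: lg_power flip: power_add)

lemma lg_inverse: "x \<noteq> 0 \<Longrightarrow> lg (inverse x) = - lg x"
  using lg_mult[of x "inverse x"] lg_power[of 0] by (intro minus_unique[symmetric]) simp

lemma double_eq_0: "x + x = (0 :: 'f)"
  using char_2_if_card_power_2[OF card_f] by simp

lemma minus_eq: "- x = (x :: 'f)"
  by (rule minus_unique) (rule double_eq_0)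

lemma diff_eq_add: "x - y = x + (y :: 'f)"
  by (subst diff_conv_add_uminus) (simp only: minus_eq)

lemma freshman: "(x + y) ^ 2 ^ b = x ^ 2 ^ b + (y :: 'f) ^ 2 ^ b"
proof (induction b)
  case (Suc b)
  have sq: "(x + y) ^ 2 = x ^ 2 + y ^ 2" for x y :: 'f
    by (simp only: power2_sum mult_2 distrib_right double_eq_0 mult_zero_left add_0_right)
  have "z ^ 2 ^ Suc b = (z ^ 2 ^ b) ^ 2" for z :: 'f by (simp only: power_Suc2 power_mult)
  then show ?case by (simp only: Suc sq)
qed simp

section \<open>The subfield and the clique-coclique bound\<close>

text \<open>F is GF(B) for \<open>B = 2 ^ 2 ^ j\<close>, obtained as the fixed points of the
  Frobenius power x -> x^B. Its nonzero elements are the powers of \<open>w ^ n\<close>, where n is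
  a multiple of \<open>B + 1\<close> and hence of p, so their logarithms vanish modulo p.\<close>

lemma subfield:
  obtains F :: "'f set" where "CARD('p) - 1 \<le> card F" "\<And>x y. x \<in> F \<Longrightarrow> y \<in> F \<Longrightarrow> x - y \<in> F"
    "\<And>x. x \<in> F \<Longrightarrow> x \<noteq> 0 \<Longrightarrow> lg x = 0"
proof -
  obtain j m where jm: "2 ^ 2 ^ s - 1 = (2 ^ 2 ^ j - 1) * (2 ^ 2 ^ j + 1) * (m :: nat)"
    and p: "CARD('p) dvd 2 ^ 2 ^ j + 1"
    using fermat_factor[OF prime_card dvd] .
  define B :: nat where "B = 2 ^ 2 ^ j"
  define n where "n = (B + 1) * m"
  have N: "2 ^ 2 ^ s - 1 = (B - 1) * n" unfolding n_def B_def jm by (simp only: mult.assoc)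
  have B: "B \<ge> 2" unfolding B_def using power_increasing[of 1 "2 ^ j" "2 :: nat"] by simp
  define F where "F = {x :: 'f. x ^ B = x}"
  have pow: "(w ^ k) ^ (B - 1) = 1 \<longleftrightarrow> n dvd k" for k
  proof -
    have "(w ^ k) ^ (B - 1) = w ^ ((B - 1) * k)" by (simp only: power_mult[symmetric] mult.commute)
    then show ?thesis using B by (simp only: power_eq_1_iff N) (simp add: nat_mult_dvd_cancel1)
  qed
  have F_iff: "x \<in> F \<longleftrightarrow> x ^ (B - 1) = 1" if "x \<noteq> 0" for x
  proof -
    have "x ^ B = x * x ^ (B - 1)" using B by (simp flip: power_Suc)
    then show ?thesis unfolding F_def using that by simp
  qed
  \<comment> \<open>These B - 1 distinct powers together with 0 give F at least B elements, and p <=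
    B + 1 because p divides \<open>B + 1\<close>.\<close>
  have inj: "inj_on (\<lambda>k. w ^ (n * k)) {..<B - 1}"
  proof (rule inj_onI, rule ccontr)
    fix i k assume ik: "i \<in> {..<B - 1}" "k \<in> {..<B - 1}" "w ^ (n * i) = w ^ (n * k)" "i \<noteq> k"
    have "False" if "i < k" "k < B - 1" "w ^ (n * i) = w ^ (n * k)" for i k
    proof -
      have "w ^ (n * (k - i)) = 1"
        using power_diff_eq_1[OF that(3)] that(1) by (simp add: diff_mult_distrib2)
      then have "n * (B - 1) dvd n * (k - i)" by (simp only: power_eq_1_iff N mult.commute)
      then have "B - 1 dvd k - i" using exp_pos unfolding N by (subst (asm) nat_mult_dvd_cancel1) auto
      then show False using that by (auto dest: dvd_imp_le)
    qed
    then show False using ik by (metis lessThan_iff linorder_neqE_nat)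
  qed
  have "w ^ (n * k) \<in> F" for k using F_iff[of "w ^ (n * k)"] pow[of "n * k"] w_nonzero by simp
  moreover have "0 \<in> F" using B by (simp add: F_def)
  ultimately have "insert 0 ((\<lambda>k. w ^ (n * k)) ` {..<B - 1}) \<subseteq> F" by blast
  then have "card (insert 0 ((\<lambda>k. w ^ (n * k)) ` {..<B - 1})) \<le> card F" by (intro card_mono) auto
  moreover have "card (insert 0 ((\<lambda>k. w ^ (n * k)) ` {..<B - 1})) = Suc (B - 1)"
    using w_nonzero card_image[OF inj] by (subst card_insert_disjoint) auto
  moreover have "CARD('p) \<le> B + 1" using p unfolding B_def by (intro dvd_imp_le) auto
  ultimately have "CARD('p) - 1 \<le> card F" using B by simp
  moreover have "x - y \<in> F" if "x \<in> F" "y \<in> F" for x y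
    using that freshman[of x y "2 ^ j"] by (simp add: F_def diff_eq_add B_def)
  moreover have "lg x = 0" if "x \<in> F" "x \<noteq> 0" for x
  proof -
    obtain k where k: "x = w ^ k" using power_surj \<open>x \<noteq> 0\<close> .
    then have "n dvd k" using that F_iff pow by simp
    then have "CARD('p) dvd k" using p unfolding n_def B_def by (meson dvd_mult2 dvd_trans)
    then show ?thesis by (auto simp: k lg_power dvd_def)
  qed
  ultimately show thesis using that by blast
qed

text \<open>This is the clique-coclique bound in the Cayley graph on GF(2^a) whose connection set
  consists of the nonzero elements with logarithm in D: X is a clique and \<open>w ^ i * F\<close>
  is a coclique.\<close>

lemma clique_coclique:
  fixes X :: "'f set"
  assumes "D \<noteq> UNIV" "\<And>x y. x \<in> X \<Longrightarrow> y \<in> X \<Longrightarrow> x \<noteq> y \<Longrightarrow> lg (x - y) \<in> D"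
  shows "card X * (CARD('p) - 1) \<le> 2 ^ 2 ^ s"
proof -
  obtain F :: "'f set" where F: "CARD('p) - 1 \<le> card F"
    "\<And>x y. x \<in> F \<Longrightarrow> y \<in> F \<Longrightarrow> x - y \<in> F" "\<And>x. x \<in> F \<Longrightarrow> x \<noteq> 0 \<Longrightarrow> lg x = 0"
    by (rule subfield) blast
  obtain e where e: "e \<notin> D" using assms(1) by blast
  obtain i where i: "e = of_nat i" using surj_of_nat_mod_ring[of e] by blast
  have "inj_on (\<lambda>(x, y). x + w ^ i * y) (X \<times> F)"
  proof (rule inj_onI, clarify)
    fix x y x' y' assume *: "x \<in> X" "y \<in> F" "x' \<in> X" "y' \<in> F" "x + w ^ i * y = x' + w ^ i * y'"
    \<comment> \<open>Equal sums with distinct x and x' would make \<open>x - x'\<close> a nonzero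
      element of \<open>w ^ i * F\<close>, with logarithm e outside D.\<close>
    then have d: "x - x' = w ^ i * (y' - y)" by (simp add: algebra_simps)
    have "x = x'"
    proof (rule ccontr)
      assume "x \<noteq> x'"
      then have nz: "y' - y \<noteq> 0" using d by auto
      have "lg (x - x') = e"
        unfolding d by (subst lg_mult) (use w_nonzero nz F * in \<open>auto simp: lg_power i\<close>)
      then show False using assms(2)[of x x'] * \<open>x \<noteq> x'\<close> e by simp
    qed
    then show "x = x' \<and> y = y'" using d w_nonzero by simp
  qed
  then have "card (X \<times> F) \<le> CARD('f)" by (intro card_inj_on_le) auto
  then show ?thesis
    using F(1) unfolding card_f card_cartesian_product by (meson dual_order.trans mult_le_mono2)
qed

text \<open>p divides an odd number and so is odd; this makes halving possible in Z_p.\<close>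

lemma two_nonzero: "(2 :: 'p mod_ring) \<noteq> 0"
proof
  assume "(2 :: 'p mod_ring) = 0"
  then have "CARD('p) dvd 2"
    using of_nat_0_mod_ring_dvd[of 2, where 'a = 'p] by simp
  then have "CARD('p) = 2" using prime_card[where 'a = 'p] by (simp add: primes_dvd_imp_eq)
  then show False using dvd exp_pos by simp
qed

text \<open>The map d -> c - 2d permutes Z_p, so the preimage of a proper U is again proper and can
  serve as D. The condition has the form of adjacency between finite vertices with equal second
  coordinate, where c is twice that coordinate.\<close>

lemma affine_clique_coclique:
  fixes X :: "'f set"
  assumes "U \<noteq> UNIV"
    "\<And>x y. x \<in> X \<Longrightarrow> y \<in> X \<Longrightarrow> x \<noteq> y \<Longrightarrow> c - 2 * lg (x - y) \<in> U"
  shows "card X * (CARD('p) - 1) \<le> 2 ^ 2 ^ s"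
proof (rule clique_coclique)
  obtain c' where "c' \<notin> U" using assms(1) by blast
  then have "(c - c') / 2 \<notin> {d. c - 2 * d \<in> U}" using two_nonzero by simp
  then show "{d. c - 2 * d \<in> U} \<noteq> UNIV" by blast
qed (use assms(2) in simp)

section \<open>Labels of edges and cliques inside a block\<close>

abbreviation "G \<equiv> MS_graph w S U"

abbreviation adj :: "'f option \<times> 'p mod_ring \<Rightarrow> 'f option \<times> 'p mod_ring \<Rightarrow> bool" (infix "\<sim>" 50)
  where "v \<sim> v' \<equiv> v' \<in> MS_nbhd w S U v"

lemma
  shows adj_inf_inf: "(None, r) \<sim> (None, t) \<Longrightarrow> t - r \<in> S"
    and adj_inf_fin: "(None, r) \<sim> (Some x, t) \<Longrightarrow> t - r \<in> U"
    and adj_fin_inf: "(Some x, r) \<sim> (None, t) \<Longrightarrow> r - t \<in> U"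
    and adj_same: "(Some x, r) \<sim> (Some x, t) \<Longrightarrow> t - r \<in> S"
  using w_nonzero by (auto simp: MS_nbhd_simps)

text \<open>Distinct x and y rule out the edges from S. The remaining ones have
  \<open>y - x = w ^ i\<close> and t = -r + u + 2i, which is solved for the label u.\<close>

lemma adj_fin_fin: "(Some x, r) \<sim> (Some y, t) \<Longrightarrow> x \<noteq> y \<Longrightarrow> r + t - 2 * lg (y - x) \<in> U"
  by (auto simp: MS_nbhd_simps lg_power)

lemma clique_adj: "clique G K \<Longrightarrow> x \<in> K \<Longrightarrow> y \<in> K \<Longrightarrow> x \<noteq> y \<Longrightarrow> x \<sim> y"
  unfolding clique_def by (auto simp: MS_graph_def arcs_ends_def arc_to_ends_def with_proj_def)

lemma adj_same_block: "(b, r) \<sim> (b, t) \<Longrightarrow> t - r \<in> S"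
  by (cases b) (auto dest: adj_inf_inf adj_same)

lemma card_block:
  "card {v \<in> K. fst v = b} = card {r. (b, r) \<in> K}"
proof -
  have "{v \<in> K. fst v = b} = Pair b ` {r. (b, r) \<in> K}" by force
  then show ?thesis by (simp add: card_image inj_on_def)
qed

lemma block_le_1:
  assumes "clique G K" "S = {}"
  shows "card {v \<in> K. fst v = b} \<le> 1"
  unfolding card_block
proof (rule ccontr)
  assume "\<not> card {r. (b, r) \<in> K} \<le> 1"
  then have "\<not> (\<forall>r\<in>{r. (b, r) \<in> K}. \<forall>t\<in>{r. (b, r) \<in> K}. r = t)"
    by (simp add: card_le_Suc0_iff_eq)
  then obtain r t where "(b, r) \<in> K" "(b, t) \<in> K" "r \<noteq> t" by blast
  then have "t - r \<in> S" using clique_adj[OF assms(1)] adj_same_block by blast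
  then show False using assms(2) by simp
qed

lemma block_le:
  fixes b :: "'f option" and K :: "('f option \<times> 'p mod_ring) set"
  assumes "\<not> {r. (b, r) \<in> K} = UNIV"
  shows "card {v \<in> K. fst v = b} \<le> CARD('p) - 1"
proof -
  have "card {r. (b, r) \<in> K} < CARD('p mod_ring)"
    by (rule psubset_card_mono) (use assms in auto)
  then show ?thesis unfolding card_block by simp
qed

text \<open>Differences within a full block cover all nonzero residues. A vertex of K outside the
  block is adjacent to all p vertices of the block, and the labels of these edges run through all of
  Z_p.\<close>

lemma full_block:
  assumes "clique G K" "{r. (b, r) \<in> K} = UNIV"
  shows "S = UNIV - {0}" "U = UNIV \<or> card K = CARD('p)"
proof -
  have full: "(b, r) \<in> K" for r using assms(2) by blast
  have "d \<in> S" if "d \<noteq> 0" for d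
    using adj_same_block[OF clique_adj[OF assms(1) full full], of 0 d] that by simp
  then show "S = UNIV - {0}" using S_nonzero by auto
  show "U = UNIV \<or> card K = CARD('p)"
  proof (cases "\<forall>v\<in>K. fst v = b")
    case True
    then have "{v \<in> K. fst v = b} = K" by blast
    then have "card K = card {r. (b, r) \<in> K}" using card_block[of K b] by simp
    then show ?thesis using assms(2) by simp
  next
    case False
    then obtain b' t where v: "(b', t) \<in> K" "b' \<noteq> b" by auto
    then have adj: "(b, r) \<sim> (b', t)" for r using clique_adj[OF assms(1) full] by blast
    \<comment> \<open>In each case the vertex of block b is chosen so that its edge to
      \<open>(b', t)\<close> has label c.\<close>
    have "c \<in> U" for c
    proof (cases b)
      case None
      then obtain y where "b' = Some y" using v by auto
      then show ?thesis using adj_inf_fin[where r = "t - c" and x = y and t = t] adj[of "t - c"] None by simp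
    next
      case (Some x)
      show ?thesis
      proof (cases b')
        case None
        then show ?thesis using adj_fin_inf[where x = x and r = "t + c" and t = t] adj[of "t + c"] Some by simp
      next
        fix y assume y: "b' = Some y"
        then show ?thesis
          using adj[of "c - t + 2 * lg (y - x)"] Some v(2)
            adj_fin_fin[where x = x and r = "c - t + 2 * lg (y - x)" and y = y and t = t]
          by simp
      qed
    qed
    then show ?thesis by blast
  qed
qed

section \<open>Vertices of a clique outside a given block\<close>

text \<open>Each label u has a coordinate set \<open>X u\<close>, which \<open>f u\<close> maps to
  vertices. With n = p - 1 and m = 2^a, summing the clique-coclique bounds over U gives the main
  term without division.\<close>

lemma card_le_labels:
  assumes "A \<subseteq> (\<Union>u\<in>U. f u ` X u)" "\<And>u. card (X u :: 'f set) * n \<le> m"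
  shows "card A * n \<le> card U * m"
proof -
  have "card A \<le> card (\<Union>u\<in>U. f u ` X u)" using assms(1) by (intro card_mono) auto
  also have "\<dots> \<le> (\<Sum>u\<in>U. card (f u ` X u))" by (intro card_UN_le) simp
  also have "\<dots> \<le> (\<Sum>u\<in>U. card (X u))" by (intro sum_mono card_image_le) simp
  finally have "card A * n \<le> (\<Sum>u\<in>U. card (X u) * n)" by (simp flip: sum_distrib_right)
  also have "\<dots> \<le> card U * m" using sum_bounded_above[of U "\<lambda>u. card (X u) * n" m] assms(2) by simp
  finally show ?thesis .
qed

text \<open>The neighbours of \<open>(None, r)\<close> with label u outside its block all have
  second coordinate \<open>r + u\<close>, so \<open>affine_clique_coclique\<close> applies with c =
  2(r + u).\<close>

lemma outside_infinite:
  assumes "clique G K" "(None, r) \<in> K" "U \<noteq> UNIV"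
  shows "card {v \<in> K. fst v \<noteq> None} * (CARD('p) - 1) \<le> card U * 2 ^ 2 ^ s"
proof (rule card_le_labels)
  show "{v \<in> K. fst v \<noteq> None} \<subseteq> (\<Union>u\<in>U. (\<lambda>x. (Some x, r + u)) ` {x. (Some x, r + u) \<in> K})"
  proof (rule subsetI)
    fix v assume v: "v \<in> {v \<in> K. fst v \<noteq> None}"
    then obtain x t where xt: "v = (Some x, t)" by (cases v) auto
    then have "t - r \<in> U" using v clique_adj[OF assms(1,2)] adj_inf_fin by blast
    then show "v \<in> (\<Union>u\<in>U. (\<lambda>x. (Some x, r + u)) ` {x. (Some x, r + u) \<in> K})"
      using v xt by (intro UN_I[of "t - r"]) auto
  qed
  show "card {x. (Some x, r + u) \<in> K} * (CARD('p) - 1) \<le> 2 ^ 2 ^ s" for u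
  proof (rule affine_clique_coclique[OF assms(3)])
    fix x y assume *: "x \<in> {x. (Some x, r + u) \<in> K}" "y \<in> {x. (Some x, r + u) \<in> K}" "x \<noteq> y"
    then have "(Some y, r + u) \<sim> (Some x, r + u)" using clique_adj[OF assms(1)] by simp
    then have "r + u + (r + u) - 2 * lg (x - y) \<in> U" using *(3) by (intro adj_fin_fin) auto
    then show "2 * (r + u) - 2 * lg (x - y) \<in> U" by (simp only: mult_2[of "r + u"])
  qed
qed

text \<open>This follows from 1/x - 1/y = (y - x)/(xy) and y - x = x - y in characteristic 2.
  Inversion changes the logarithm of a difference only by one term in x and one in y, which the
  second coordinates in \<open>inverted\<close> absorb.\<close>

lemma lg_inverse_diff:
  assumes "x \<noteq> 0" "y \<noteq> 0" "x \<noteq> y"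
  shows "lg (x - y) = lg (inverse x - inverse y) - lg (inverse x) - lg (inverse y)"
proof -
  have "inverse x - inverse y = (y - x) * (inverse x * inverse y)"
    using assms by (simp add: field_simps)
  moreover have "y - x = x - y" by (simp add: diff_eq_add add.commute)
  ultimately have "lg (inverse x - inverse y) = lg (x - y) + (lg (inverse x) + lg (inverse y))"
    using assms by (simp add: lg_mult del: inverse_mult_distrib)
  then show ?thesis by simp
qed

(* The coordinate y stands for the block at x + 1/y, and y = 0 for the block at infinity. *)
definition inverted :: "'f \<Rightarrow> 'p mod_ring \<Rightarrow> 'p mod_ring \<Rightarrow> 'f \<Rightarrow> 'f option \<times> 'p mod_ring" where
  "inverted x r u y =
    (if y = 0 then (None, r - u) else (Some (x + inverse y), - r + u + 2 * lg (inverse y)))"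

text \<open>In the inverted coordinate, neighbours of \<open>(Some x, r)\<close> with common label u
  behave like finite vertices with common second coordinate \<open>u - r\<close>, also when one of
  them lies at infinity.\<close>

lemma inverted_adj:
  assumes "y \<noteq> z" "inverted x r u y \<sim> inverted x r u z"
  shows "2 * (u - r) - 2 * lg (y - z) \<in> U"
proof -
  consider "y = 0" "z \<noteq> 0" | "y \<noteq> 0" "z = 0" | "y \<noteq> 0" "z \<noteq> 0" using assms(1) by blast
  then show ?thesis
  proof cases
    case 1
    then have "(None, r - u) \<sim> (Some (x + inverse z), - r + u + 2 * lg (inverse z))"
      using assms(2) by (simp add: inverted_def)
    then have "- r + u + 2 * lg (inverse z) - (r - u) \<in> U" by (rule adj_inf_fin)
    moreover have "- r + u + 2 * lg (inverse z) - (r - u) = 2 * (u - r) - 2 * lg (y - z)"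
      using 1 by (simp add: lg_inverse minus_eq algebra_simps)
    ultimately show ?thesis by (simp only:)
  next
    case 2
    then have "(Some (x + inverse y), - r + u + 2 * lg (inverse y)) \<sim> (None, r - u)"
      using assms(2) by (simp add: inverted_def)
    then have "- r + u + 2 * lg (inverse y) - (r - u) \<in> U" by (rule adj_fin_inf)
    moreover have "- r + u + 2 * lg (inverse y) - (r - u) = 2 * (u - r) - 2 * lg (y - z)"
      using 2 by (simp add: lg_inverse algebra_simps)
    ultimately show ?thesis by (simp only:)
  next
    case 3
    then have "(- r + u + 2 * lg (inverse y)) + (- r + u + 2 * lg (inverse z))
        - 2 * lg ((x + inverse z) - (x + inverse y)) \<in> U"
      using assms by (intro adj_fin_fin) (auto simp: inverted_def)
    moreover have "(x + inverse z) - (x + inverse y) = inverse y - inverse z"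
      unfolding add_diff_cancel_left by (simp only: diff_eq_add add.commute)
    ultimately have "(- r + u + 2 * lg (inverse y)) + (- r + u + 2 * lg (inverse z))
        - 2 * lg (inverse y - inverse z) \<in> U"
      by (simp only:)
    moreover have "(- r + u + 2 * lg (inverse y)) + (- r + u + 2 * lg (inverse z))
        - 2 * lg (inverse y - inverse z) = 2 * (u - r) - 2 * lg (y - z)"
      unfolding lg_inverse_diff[OF 3 assms(1)] by (simp add: algebra_simps)
    ultimately show ?thesis by (simp only:)
  qed
qed

text \<open>The neighbours of \<open>(Some x, r)\<close> with label u outside its block are the
  values of \<open>inverted x r u\<close>, so moving block x to infinity reduces to the argument for
  \<open>(None, r)\<close>.\<close>

lemma outside_finite:
  assumes "clique G K" "(Some x, r) \<in> K" "U \<noteq> UNIV"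
  shows "card {v \<in> K. fst v \<noteq> Some x} * (CARD('p) - 1) \<le> card U * 2 ^ 2 ^ s"
proof (rule card_le_labels)
  show "{v \<in> K. fst v \<noteq> Some x} \<subseteq> (\<Union>u\<in>U. inverted x r u ` {y. inverted x r u y \<in> K})"
  proof (rule subsetI)
    fix v assume v: "v \<in> {v \<in> K. fst v \<noteq> Some x}"
    obtain b t where bt: "v = (b, t)" by force
    have adj: "(Some x, r) \<sim> v" using v clique_adj[OF assms(1,2)] by fastforce
    \<comment> \<open>Here u is the label of the edge to v, and y is 0 for the block at infinity and
      otherwise solves \<open>x + inverse y = z\<close>.\<close>
    have "\<exists>u\<in>U. \<exists>y. v = inverted x r u y"
    proof (cases b)
      case None
      then show ?thesis
        using adj by (intro bexI[of _ "r - t"] exI[of _ 0]) (auto simp: bt inverted_def dest: adj_fin_inf)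
    next
      case (Some z)
      then have "z \<noteq> x" using v bt by simp
      then show ?thesis
        using adj adj_fin_fin[where x = x and r = r and y = z and t = t]
        by (intro bexI[of _ "r + t - 2 * lg (z - x)"] exI[of _ "inverse (z - x)"])
          (auto simp: bt Some inverted_def simp flip: add.assoc)
    qed
    then show "v \<in> (\<Union>u\<in>U. inverted x r u ` {y. inverted x r u y \<in> K})" using v by auto
  qed
  have inj: "inverted x r u y \<noteq> inverted x r u z" if "y \<noteq> z" for u y z
    using that by (auto simp: inverted_def)
  show "card {y. inverted x r u y \<in> K} * (CARD('p) - 1) \<le> 2 ^ 2 ^ s" for u
  proof (rule affine_clique_coclique[OF assms(3)])
    fix y z assume "y \<in> {y. inverted x r u y \<in> K}" "z \<in> {y. inverted x r u y \<in> K}" "y \<noteq> z"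
    then show "2 * (u - r) - 2 * lg (y - z) \<in> U"
      using inverted_adj[of y z x r u] clique_adj[OF assms(1)] inj by blast
  qed
qed

section \<open>Bounds on the clique number\<close>

lemma clique_bound:
  assumes "clique G K" "v \<in> K" "U \<noteq> UNIV"
  shows "real (card K)
    \<le> 2 ^ 2 ^ s / (real CARD('p) - 1) * real (card U) + real (card {v' \<in> K. fst v' = fst v})"
proof -
  have p: "CARD('p) > 1" by (rule prime_gt_1_nat[OF prime_card])
  have "card {v' \<in> K. fst v' \<noteq> fst v} * (CARD('p) - 1) \<le> card U * 2 ^ 2 ^ s"
    using outside_infinite[OF assms(1) _ assms(3)] outside_finite[OF assms(1) _ assms(3)] assms(2)
    by (cases v; cases "fst v") auto
  then have "real (card {v' \<in> K. fst v' \<noteq> fst v} * (CARD('p) - 1)) \<le> real (card U * 2 ^ 2 ^ s)"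
    by (simp only: of_nat_le_iff)
  then have "real (card {v' \<in> K. fst v' \<noteq> fst v})
      \<le> 2 ^ 2 ^ s / (real CARD('p) - 1) * real (card U)"
    using p by (simp add: field_simps of_nat_diff)
  moreover have "card K \<le> card ({v' \<in> K. fst v' \<noteq> fst v} \<union> {v' \<in> K. fst v' = fst v})"
    by (intro card_mono) auto
  then have "card K \<le> card {v' \<in> K. fst v' \<noteq> fst v} + card {v' \<in> K. fst v' = fst v}"
    using card_Un_le by (rule order_trans)
  ultimately show ?thesis by linarith
qed

lemma clique_number_le:
  assumes "\<And>K. clique G K \<Longrightarrow> real (card K) \<le> c"
  shows "real (clique_number G) \<le> c"
proof -
  \<comment> \<open>The empty clique makes the set under \<open>Max\<close> nonempty, so the maximum
    is attained.\<close>
  have "clique G {}" by (simp add: clique_def)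
  then have "Max (card ` {K. clique G K}) \<in> card ` {K. clique G K}" by (intro Max_in) auto
  then show ?thesis using assms unfolding clique_number_def by auto
qed

lemma bound_nonneg: "0 \<le> 2 ^ 2 ^ s / (real CARD('p) - 1) * real (card U)"
  using prime_gt_1_nat[OF prime_card[where 'a = 'p]] by simp

text \<open>With S empty, a clique has at most one vertex in each block. For \<open>U = UNIV\<close>
  there is no residue outside D, but counting the 2^a + 1 blocks suffices since |U|/(p - 1) = p/(p -
  1) >= 1.\<close>

lemma bound_S_empty:
  assumes "clique G K" "S = {}"
  shows "real (card K) \<le> 2 ^ 2 ^ s / (real CARD('p) - 1) * real (card U) + 1"
proof (cases "U = UNIV")
  case True
  have inj: "inj_on fst K"
  proof (rule inj_onI)
    fix v v' assume v: "v \<in> K" "v' \<in> K" "fst v = fst v'"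
    have "card {x \<in> K. fst x = fst v} \<le> Suc 0" using block_le_1[OF assms] by simp
    then have "\<forall>x\<in>{x \<in> K. fst x = fst v}. \<forall>y\<in>{x \<in> K. fst x = fst v}. x = y"
      by (rule iffD1[OF card_le_Suc0_iff_eq, rotated]) simp
    from bspec[OF bspec[OF this, of v], of v'] v show "v = v'" by simp
  qed
  have "card K = card (fst ` K)" by (simp add: card_image[OF inj])
  also have "\<dots> \<le> CARD('f option)" by (intro card_mono) auto
  finally have "card K \<le> 2 ^ 2 ^ s + 1" by (simp add: card_f)
  then have "real (card K) \<le> real (2 ^ 2 ^ s + 1)" by (simp only: of_nat_le_iff)
  then have "real (card K) \<le> 2 ^ 2 ^ s + 1" by simp
  moreover have "1 \<le> real CARD('p) / (real CARD('p) - 1)"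
    using prime_gt_1_nat[OF prime_card[where 'a = 'p]] by simp
  then have "2 ^ 2 ^ s * 1 \<le> 2 ^ 2 ^ s * (real CARD('p) / (real CARD('p) - 1))"
    by (intro mult_left_mono) auto
  then have "2 ^ 2 ^ s \<le> 2 ^ 2 ^ s / (real CARD('p) - 1) * real (card U)"
    by (simp add: True)
  ultimately show ?thesis by linarith
next
  case False
  show ?thesis
  proof (cases "K = {}")
    case True
    then have "real (card K) = 0" by simp
    then show ?thesis using bound_nonneg by linarith
  next
    case nonempty: False
    then obtain v where "v \<in> K" by blast
    moreover have "real (card {v' \<in> K. fst v' = fst v}) \<le> 1" using block_le_1[OF assms] by simp
    ultimately show ?thesis using clique_bound[OF assms(1) _ False] by fastforce
  qed
qed

text \<open>If some vertex of K has a block not contained in K, that block contributes at most p -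
  1. The excluded cases contain real exceptions: for U empty and \<open>S = UNIV - {0}\<close> each
  block is a clique of size p, and for \<open>U = UNIV\<close> with the same S the whole graph is
  complete.\<close>

lemma bound_S_nonempty:
  assumes "clique G K" "U \<noteq> UNIV" "\<not> (U = {} \<and> S = UNIV - {0})"
  shows "real (card K) \<le> 2 ^ 2 ^ s / (real CARD('p) - 1) * real (card U) + real CARD('p) - 1"
proof -
  have p: "CARD('p) > 1" by (rule prime_gt_1_nat[OF prime_card])
  have le: "CARD('p) \<le> 2 ^ 2 ^ s - 1" using dvd exp_pos by (intro dvd_imp_le)
  consider "K = {}" | b where "{r. (b, r) \<in> K} = UNIV"
    | v where "v \<in> K" "{r. (fst v, r) \<in> K} \<noteq> UNIV" by blast
  then show ?thesis
  proof cases
    case 1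
    then have "real (card K) = 0" "1 \<le> real CARD('p)" using p by auto
    then show ?thesis using bound_nonneg by linarith
  next
    case 2
    then have K: "card K = CARD('p)" and "U \<noteq> {}" using full_block[OF assms(1)] assms(2,3) by auto
    then have "card U \<ge> 1" by (simp add: Suc_leI card_gt_0_iff)
    \<comment> \<open>K is a single block of size p = (p - 1) + 1. The extra 1 is covered by the
      term in U, since p - 1 <= 2^a and U is nonempty.\<close>
    have "real CARD('p) \<le> real (2 ^ 2 ^ s - 1)" using le by (simp only: of_nat_le_iff)
    then have "real CARD('p) - 1 \<le> 2 ^ 2 ^ s" by (simp add: of_nat_diff)
    then have "1 \<le> 2 ^ 2 ^ s / (real CARD('p) - 1)" using p by (simp add: field_simps)
    then have "1 * 1 \<le> 2 ^ 2 ^ s / (real CARD('p) - 1) * real (card U)"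
      using \<open>card U \<ge> 1\<close> by (intro mult_mono) auto
    then show ?thesis using K by simp
  next
    case 3
    have "card {v' \<in> K. fst v' = fst v} \<le> CARD('p) - 1" by (rule block_le) (rule 3(2))
    then have "real (card {v' \<in> K. fst v' = fst v}) \<le> real CARD('p) - 1" using p by linarith
    then show ?thesis using clique_bound[OF assms(1) 3(1) assms(2)] by linarith
  qed
qed

end

theorem theorem5p7:
  fixes s a q p :: nat
    and w :: "'f :: {field, finite}"
    and S U :: "'p :: prime_card mod_ring set"
  assumes "s \<ge> 1" and "a = 2 ^ s"
    and "q = 2 ^ a + 1" and "fermat_prime q"
    and "prime p" and "p dvd 2 ^ a - 1"
    and "CARD('f) = 2 ^ a" and "primitive_element w"
    and "CARD('p) = p"
    and "S \<subseteq> UNIV - {0}" and "uminus ` S = S"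
  shows
    "(S = {} \<longrightarrow>
        real (clique_number (MS_graph w S U)) \<le> 2 ^ a / (real p - 1) * real (card U) + 1) \<and>
     (S \<noteq> {} \<longrightarrow> U \<noteq> UNIV \<longrightarrow> \<not> (U = {} \<and> S = UNIV - {0}) \<longrightarrow>
        real (clique_number (MS_graph w S U)) \<le> 2 ^ a / (real p - 1) * real (card U) + real p - 1)"
proof -
  interpret marusic_scapellato w S U s
    using assms by unfold_locales auto
  have p: "p = CARD('p)" using assms(9) by simp
  show ?thesis
    unfolding p assms(2)
    by (intro conjI impI clique_number_le bound_S_empty bound_S_nonempty)
qed

end
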